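(* Let $G=(V,E)$ be a $\lambda$-expander graph, $l\ge1$, and $f:V\to\{0,1\}$ with $\mu:=\mathbb E_{v\sim U(V)} f(v)$. Let $\gamma$ be real with $\mu+\lambda\le\gamma\le 1$. Then \[ \Pr_{w\sim\mathrm{Walk}(G,l)}\Big(\textstyle\sum_{i\in[l]} f(w_i)\ge \gamma l\Big)\le \exp\big(-l\,D(\gamma\,\|\,\mu+\lambda)\big). \]
   Context: $[l]:=\{0,\dots,l-1\}$; $U(V)$ is the uniform distribution on $V$. $D(p\|q):=p\ln\frac pq+(1-p)\ln\frac{1-p}{1-q}$ is the Kullback–Leibler divergence between Bernoulli distributions (with $0\ln 0=0$ and $\exp(-\infty)=0$). Graphs are finite, undirected, may have parallel edges and self-loops; the adjacency matrix $A=(a_{uv})$ counts edges between $u$ and $v$; the graph is $d$-regular ($d\ge1$) if $A$ is symmetric with all row sums $d$; it is a $\lambda$-expander if it is $d$-regular and the second largest absolute value of the eigenvalues of $A$ (with multiplicity) is at most $d\lambda$. $\mathrm{Walk}(G,l)$ is the distribution of $w=(w_0,\dots,w_{l-1})$ where $w_0$ is uniform on $V$ and $w_{i+1}=u$ with probability $a_{w_iu}/d$ given the past. *)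

theory Defs
  imports "HOL-Probability.Probability" "HOL-Computational_Algebra.Fundamental_Theorem_Algebra"
    "Jordan_Normal_Form.Char_Poly"
begin

text \<open>Graphs: vertex set V = {0..<n}; adjacency matrix A :: nat => nat => nat
  (A u v = number of edges between u and v, self-loops allowed).\<close>

definition regular :: "nat \<Rightarrow> (nat \<Rightarrow> nat \<Rightarrow> nat) \<Rightarrow> nat \<Rightarrow> bool" where
  "regular n A d \<longleftrightarrow> d \<ge> 1 \<and> (\<forall>u<n. \<forall>v<n. A u v = A v u) \<and> (\<forall>u<n. (\<Sum>v<n. A u v) = d)"

definition adj_mat :: "nat \<Rightarrow> (nat \<Rightarrow> nat \<Rightarrow> nat) \<Rightarrow> complex mat" where
  "adj_mat n A = mat n n (\<lambda>(i,j). of_nat (A i j))"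

definition eigenvalues_mset :: "nat \<Rightarrow> (nat \<Rightarrow> nat \<Rightarrow> nat) \<Rightarrow> complex multiset" where
  "eigenvalues_mset n A = proots (char_poly (adj_mat n A))"

text \<open>Second largest absolute value of the eigenvalues (with multiplicity) is at most d*lambda:
  after removing one copy of an eigenvalue of largest absolute value, all remaining ones are
  bounded by d*lambda.\<close>
definition expander :: "nat \<Rightarrow> (nat \<Rightarrow> nat \<Rightarrow> nat) \<Rightarrow> nat \<Rightarrow> real \<Rightarrow> bool" where
  "expander n A d lam \<longleftrightarrow> regular n A d \<and>
     (let M = eigenvalues_mset n A in
       \<exists>e\<in>#M. (\<forall>x\<in>#M. cmod x \<le> cmod e) \<and> (\<forall>x\<in>#M - {#e#}. cmod x \<le> real d * lam))"

definition step_pmf :: "nat \<Rightarrow> (nat \<Rightarrow> nat \<Rightarrow> nat) \<Rightarrow> nat \<Rightarrow> nat pmf" where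
  "step_pmf n A u = pmf_of_multiset (\<Sum>v\<in>{..<n}. replicate_mset (A u v) v)"

fun walk_pmf :: "nat \<Rightarrow> (nat \<Rightarrow> nat \<Rightarrow> nat) \<Rightarrow> nat \<Rightarrow> nat list pmf" where
  "walk_pmf n A 0 = return_pmf []"
| "walk_pmf n A (Suc l) =
     (if l = 0 then map_pmf (\<lambda>v. [v]) (pmf_of_set {..<n})
      else bind_pmf (walk_pmf n A l) (\<lambda>w. map_pmf (\<lambda>v. w @ [v]) (step_pmf n A (last w))))"

definition kl_term :: "real \<Rightarrow> real \<Rightarrow> ereal" where
  "kl_term a b = (if a = 0 then 0 else if b = 0 then \<infinity> else ereal (a * ln (a / b)))"

definition KL :: "real \<Rightarrow> real \<Rightarrow> ereal" where
  "KL p q = kl_term p q + kl_term (1 - p) (1 - q)"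

definition exp_ereal :: "ereal \<Rightarrow> real" where
  "exp_ereal x = (case x of ereal r \<Rightarrow> exp r | MInfty \<Rightarrow> 0 | PInfty \<Rightarrow> 0)"

end

theory Submission
  imports Defs "Jordan_Normal_Form.Schur_Decomposition" "HOL-Real_Asymp.Real_Asymp"
begin

text \<open>
  A Chernoff bound. Let \<open>M = A/d\<close> and \<open>D = diag(e\<^bsup>t f\<^esup>)\<close> with \<open>t \<ge> 0\<close>.

  The hypothesis on the spectrum gives \<open>|My| \<le> \<lambda>|y|\<close> for \<open>y\<close> orthogonal to the constants, by the
  trace method: Bessel's inequality on the rows of \<open>M\<^sup>k\<close> yields \<open>|M\<^sup>k y|\<^sup>2 \<le> (tr M\<^bsup>2k\<^esup> - 1)|y|\<^sup>2\<close>, and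
  \<open>tr M\<^bsup>2k\<^esup>\<close>, the sum of the \<open>2k\<close>-th powers of the eigenvalues, is at most \<open>1 + (n - 1)\<lambda>\<^bsup>2k\<^esup>\<close>. As
  \<open>|M\<^sup>k y|\<^sup>2\<close> is log-convex in \<open>k\<close>, its first ratio is at most its exponential growth rate \<open>\<lambda>\<^sup>2\<close>.

  Hence \<open>M\<close> differs from \<open>1 - \<lambda>\<close> times the averaging projection by an operator of norm at most \<open>\<lambda>\<close>,
  and \<open>D\<^bsup>1/2\<^esup> M D\<^bsup>1/2\<^esup>\<close> has norm at most \<open>(1 - \<lambda>)(1 + \<mu>(e\<^sup>t - 1)) + \<lambda>e\<^sup>t \<le> 1 + (\<mu> + \<lambda>)(e\<^sup>t - 1)\<close>. So
  the moment generating function of the number of hits is at most that of a binomial variable with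
  parameters \<open>l\<close> and \<open>\<mu> + \<lambda>\<close>; Markov's inequality with the optimal \<open>t\<close> gives the divergence.
\<close>

unbundle no inner_syntax
unbundle no vec_syntax

subsection \<open>Traces of matrix powers\<close>

definition mat_trace :: "'a :: comm_monoid_add mat \<Rightarrow> 'a" where
  "mat_trace A = (\<Sum>i<dim_row A. A $$ (i, i))"

lemma mat_trace_mult:
  assumes "A \<in> carrier_mat n m" "B \<in> carrier_mat m n"
  shows "mat_trace (A * B) = (\<Sum>i<n. \<Sum>j<m. A $$ (i, j) * B $$ (j, i))"
  using assms by (simp add: mat_trace_def scalar_prod_def lessThan_atLeast0)

lemma mat_trace_mult_commute:
  fixes A :: "'a :: comm_semiring_0 mat"
  assumes "A \<in> carrier_mat n m" "B \<in> carrier_mat m n"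
  shows "mat_trace (A * B) = mat_trace (B * A)"
  unfolding mat_trace_mult[OF assms] mat_trace_mult[OF assms(2,1)]
  by (subst sum.swap) (simp add: mult.commute)

lemma mat_trace_similar:
  fixes A :: "'a :: comm_ring_1 mat"
  assumes "similar_mat A B"
  shows "mat_trace A = mat_trace B"
proof -
  obtain n P Q where carrier: "{A, B, P, Q} \<subseteq> carrier_mat n n"
    and QP: "Q * P = 1\<^sub>m n" and A: "A = P * B * Q"
    by (meson similar_matD[OF assms])
  have "mat_trace A = mat_trace (Q * (P * B))"
    unfolding A by (rule mat_trace_mult_commute) (use carrier in auto)
  also have "Q * (P * B) = Q * P * B"
    by (rule assoc_mult_mat[symmetric]) (use carrier in auto)
  also have "Q * P * B = B"
    unfolding QP by (rule left_mult_one_mat) (use carrier in auto)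
  finally show ?thesis .
qed

lemma upper_triangular_mult_index:
  fixes A B :: "'a :: semiring_0 mat"
  assumes A: "A \<in> carrier_mat n n" "upper_triangular A"
    and B: "B \<in> carrier_mat n n" "upper_triangular B"
    and "i < n" "j \<le> i"
  shows "(A * B) $$ (i, j) = (if i = j then A $$ (i, i) * B $$ (i, i) else 0)"
proof -
  have "A $$ (i, k) = 0 \<or> B $$ (k, j) = 0" if "k < n" "k \<noteq> i \<or> i \<noteq> j" for k
    using assms that upper_triangularD[OF A(2), of k i] upper_triangularD[OF B(2), of j k]
    by (cases "k < i") auto
  then have "A $$ (i, k) * B $$ (k, j) = (if k = i \<and> i = j then A $$ (i, i) * B $$ (i, i) else 0)"
    if "k < n" for k
    using that by fastforce
  then show ?thesis
    using assms by (simp add: scalar_prod_def)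
qed

lemma upper_triangular_pow_mat_diag:
  fixes A :: "'a :: semiring_1 mat"
  assumes A: "A \<in> carrier_mat n n" "upper_triangular A" and i: "i < n"
  shows "(A ^\<^sub>m k) $$ (i, i) = A $$ (i, i) ^ k"
proof -
  have "upper_triangular (A ^\<^sub>m k) \<and> (\<forall>i<n. (A ^\<^sub>m k) $$ (i, i) = A $$ (i, i) ^ k)"
  proof (induction k)
    case 0
    show ?case using A by simp
  next
    case (Suc k)
    have "(A ^\<^sub>m Suc k) $$ (i, j) = (if i = j then (A ^\<^sub>m k) $$ (i, i) * A $$ (i, i) else 0)"
      if "i < n" "j \<le> i" for i j
      using upper_triangular_mult_index[of "A ^\<^sub>m k" n A i j] A Suc.IH that by simp
    then show ?case using A Suc.IH
      by (auto simp: power_commutes simp del: pow_mat.simps)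
  qed
  then show ?thesis
    using i by simp
qed

lemma proots_prod_list_linear_factors:
  fixes as :: "'a :: idom list"
  shows "proots (\<Prod>a\<leftarrow>as. [:- a, 1:]) = mset as"
proof (induction as)
  case (Cons a as)
  have "(\<Prod>a\<leftarrow>as. [:- a, 1:]) \<noteq> 0"
    by (auto simp: prod_list_zero_iff)
  then show ?case
    using Cons by (simp add: proots_mult del: mult_pCons_left)
qed simp

lemma mat_trace_pow_eq_sum_proots:
  fixes A :: "complex mat"
  assumes A: "A \<in> carrier_mat n n"
  shows "mat_trace (A ^\<^sub>m k) = (\<Sum>x\<in>#proots (char_poly A). x ^ k)"
proof -
  obtain es where "char_poly A = (\<Prod>e\<leftarrow>es. [:- e, 1:])"
    using char_poly_factorized[OF A] by blast
  from schur_decomposition_exists[OF A this]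
  obtain B where B: "B \<in> carrier_mat n n" "upper_triangular B" and similar: "similar_mat A B"
    by blast
  have "proots (char_poly A) = mset (diag_mat B)"
    unfolding char_poly_similar[OF similar] char_poly_upper_triangular[OF B]
    by (rule proots_prod_list_linear_factors)
  then have "(\<Sum>x\<in>#proots (char_poly A). x ^ k) = (\<Sum>i<n. B $$ (i, i) ^ k)"
    using B(1) by (simp add: diag_mat_def sum_unfold_sum_mset lessThan_atLeast0
        multiset.map_comp comp_def)
  also have "\<dots> = mat_trace (B ^\<^sub>m k)"
    using B by (simp add: mat_trace_def upper_triangular_pow_mat_diag)
  also have "\<dots> = mat_trace (A ^\<^sub>m k)"
    using similar similar_mat_wit_pow mat_trace_similar unfolding similar_mat_def by metis
  finally show ?thesis by simp
qed

lemma pow_mat_add: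
  fixes A :: "'a :: semiring_1 mat"
  assumes "A \<in> carrier_mat n n"
  shows "A ^\<^sub>m (k + l) = A ^\<^sub>m k * A ^\<^sub>m l"
proof (induction l)
  case (Suc l)
  then show ?case
    using assms by (simp add: assoc_mult_mat[of _ n n _ n _ n])
qed (use assms in simp)

lemma transpose_pow_mat:
  fixes A :: "'a :: comm_semiring_1 mat"
  assumes A: "A \<in> carrier_mat n n"
  shows "(A ^\<^sub>m k)\<^sup>T = A\<^sup>T ^\<^sub>m k"
proof (induction k)
  case (Suc k)
  have "(A ^\<^sub>m Suc k)\<^sup>T = A\<^sup>T * A\<^sup>T ^\<^sub>m k"
    using A Suc by (simp add: transpose_mult[of _ n n _ n])
  also have "\<dots> = A\<^sup>T ^\<^sub>m Suc k"
    using pow_mat_add[of "A\<^sup>T" n 1 k] A by simp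
  finally show ?case .
qed (use A in simp)

subsection \<open>Log-convex sequences\<close>

context
  fixes a :: "nat \<Rightarrow> real"
  assumes nonneg: "\<And>k. 0 \<le> a k"
    and log_convex: "\<And>k. (a (Suc k))\<^sup>2 \<le> a k * a (Suc (Suc k))"
begin

lemma log_convex_ratio_le: "a 1 * a k \<le> a 0 * a (Suc k)"
proof (induction k)
  case (Suc k)
  show ?case
  proof (cases "a (Suc k) = 0")
    case False
    have "a 1 * a (Suc k) * a (Suc k) \<le> a 1 * (a k * a (Suc (Suc k)))"
      using mult_left_mono[OF log_convex[of k] nonneg[of 1]] by (simp add: power2_eq_square)
    also have "\<dots> \<le> a 0 * a (Suc k) * a (Suc (Suc k))"
      using mult_right_mono[OF Suc.IH nonneg[of "Suc (Suc k)"]] by simp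
    finally have "a (Suc k) * (a 1 * a (Suc k)) \<le> a (Suc k) * (a 0 * a (Suc (Suc k)))"
      by (simp add: mult_ac)
    then show ?thesis
      using False nonneg[of "Suc k"] by (simp add: mult_le_cancel_left)
  qed (simp add: nonneg)
qed simp

lemma log_convex_power_le: "a 1 ^ k * a 0 \<le> a 0 ^ k * a k"
proof (induction k)
  case (Suc k)
  have "a 1 ^ Suc k * a 0 \<le> a 1 * (a 0 ^ k * a k)"
    using mult_left_mono[OF Suc.IH nonneg[of 1]] by simp
  also have "\<dots> = a 0 ^ k * (a 1 * a k)"
    by simp
  also have "\<dots> \<le> a 0 ^ k * (a 0 * a (Suc k))"
    by (intro mult_left_mono log_convex_ratio_le zero_le_power nonneg)
  finally show ?case
    by (simp add: mult_ac)
qed simp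

lemma log_convex_first_ratio_le:
  assumes geometric: "\<And>k. a k \<le> c * r ^ k" and r: "0 \<le> r"
  shows "a 1 \<le> r * a 0"
proof (rule ccontr)
  assume less: "\<not> ?thesis"
  have "a 0 \<noteq> 0"
    using log_convex[of 0] less by auto
  then have a0: "0 < a 0"
    using nonneg[of 0] by simp
  define q where "q = a 1 / a 0"
  have q: "r < q"
    using less a0 by (simp add: q_def field_simps)
  have growth: "a 0 * q ^ k \<le> c * r ^ k" for k
  proof -
    have "a 0 ^ k * (a 0 * q ^ k) = a 1 ^ k * a 0"
      using a0 by (simp add: q_def power_divide)
    also have "\<dots> \<le> a 0 ^ k * a k"
      by (rule log_convex_power_le)
    finally show ?thesis
      using a0 geometric[of k] by (simp add: mult_le_cancel_left_pos)
  qed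
  have "r \<noteq> 0"
    using growth[of 1] a0 q by (auto simp: mult_le_0_iff)
  then have "0 < r"
    using r by simp
  have "(q / r) ^ k \<le> c / a 0" for k
    using growth[of k] a0 \<open>0 < r\<close> by (simp add: power_divide field_simps)
  moreover obtain k where "c / a 0 < (q / r) ^ k"
    using real_arch_pow[of "q / r"] q \<open>0 < r\<close> by auto
  ultimately show False
    by (meson not_le)
qed

end

subsection \<open>Symmetric matrices on the complement of an eigenvector\<close>

lemma scalar_prod_self_nonneg:
  fixes x :: "real vec"
  shows "0 \<le> x \<bullet> x"
  using conjugate_square_ge_0_vec[of x] by simp

lemma scalar_prod_Cauchy_Schwarz:
  fixes x y :: "real vec"
  assumes "x \<in> carrier_vec n" "y \<in> carrier_vec n"
  shows "(x \<bullet> y)\<^sup>2 \<le> (x \<bullet> x) * (y \<bullet> y)"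
  using Cauchy_Schwarz_ineq_sum[of "($) x" "($) y" "{0..<n}"] assms
  by (simp add: scalar_prod_def power2_eq_square)

lemma scalar_prod_Bessel:
  fixes x u v :: "real vec"
  assumes carrier: "x \<in> carrier_vec n" "u \<in> carrier_vec n" "v \<in> carrier_vec n"
    and orth: "u \<bullet> x = 0" and u: "u \<bullet> u \<noteq> 0"
  shows "(v \<bullet> x)\<^sup>2 \<le> (v \<bullet> v - (v \<bullet> u)\<^sup>2 / (u \<bullet> u)) * (x \<bullet> x)"
proof -
  define c where "c = (v \<bullet> u) / (u \<bullet> u)"
  define w where "w = v - c \<cdot>\<^sub>v u"
  have w: "w \<in> carrier_vec n"
    using carrier by (simp add: w_def)
  have prods: "w \<bullet> y = v \<bullet> y - c * (u \<bullet> y)" if "y \<in> carrier_vec n" for y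
    unfolding w_def using carrier that by (subst minus_scalar_prod_distrib[of _ n]) auto
  have "w \<bullet> u = 0"
    using prods[of u] carrier u by (simp add: c_def)
  have "w \<bullet> w = v \<bullet> w"
    using prods[OF w] comm_scalar_prod[OF w carrier(2)] \<open>w \<bullet> u = 0\<close> by simp
  also have "\<dots> = v \<bullet> v - c * (v \<bullet> u)"
    using prods[of v] carrier comm_scalar_prod[OF w carrier(3)] comm_scalar_prod[OF carrier(2,3)]
    by simp
  finally have "w \<bullet> w = v \<bullet> v - (v \<bullet> u)\<^sup>2 / (u \<bullet> u)"
    by (simp add: c_def power2_eq_square)
  moreover have "w \<bullet> x = v \<bullet> x"
    using prods[of x] carrier orth by simp
  ultimately show ?thesis
    using scalar_prod_Cauchy_Schwarz[OF w carrier(1)] by simp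
qed

lemma mat_trace_square_symmetric:
  fixes S :: "'a :: semiring_0 mat"
  assumes S: "S \<in> carrier_mat n n" and sym: "S\<^sup>T = S"
  shows "mat_trace (S * S) = (\<Sum>i<n. row S i \<bullet> row S i)"
proof -
  have "row S i = col S i" if "i < n" for i
    using S that row_transpose[of i S] by (simp add: sym)
  then show ?thesis
    using S by (simp add: mat_trace_def)
qed

lemma symmetric_orth_eigenvector_le_trace:
  fixes S :: "real mat"
  assumes S: "S \<in> carrier_mat n n" "S\<^sup>T = S" and u: "eigenvector S u s"
    and x: "x \<in> carrier_vec n" "u \<bullet> x = 0"
  shows "(S *\<^sub>v x) \<bullet> (S *\<^sub>v x) \<le> (mat_trace (S * S) - s\<^sup>2) * (x \<bullet> x)"
proof -
  have u_vec: "u \<in> carrier_vec n" and "u \<noteq> 0\<^sub>v n" and Su: "S *\<^sub>v u = s \<cdot>\<^sub>v u"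
    using u S(1) by (simp_all add: eigenvector_def)
  then have u_nz: "u \<bullet> u \<noteq> 0"
    using conjugate_square_eq_0_vec[of u n] by simp
  have row_u: "row S i \<bullet> u = s * u $ i" if "i < n" for i
    using arg_cong[OF Su, of "\<lambda>v. v $ i"] S(1) u_vec that by simp
  have "(S *\<^sub>v x) \<bullet> (S *\<^sub>v x) = (\<Sum>i<n. (row S i \<bullet> x)\<^sup>2)"
    using S(1) by (simp add: scalar_prod_def[of "S *\<^sub>v x"] power2_eq_square lessThan_atLeast0)
  also have "\<dots> \<le> (\<Sum>i<n. (row S i \<bullet> row S i - (row S i \<bullet> u)\<^sup>2 / (u \<bullet> u)) * (x \<bullet> x))"
    by (intro sum_mono scalar_prod_Bessel[OF x(1) u_vec _ x(2) u_nz]) (use S(1) in auto)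
  also have "\<dots> = (mat_trace (S * S) - (\<Sum>i<n. s\<^sup>2 * (u $ i)\<^sup>2) / (u \<bullet> u)) * (x \<bullet> x)"
    by (simp add: mat_trace_square_symmetric[OF S] row_u power_mult_distrib sum_subtractf
        sum_divide_distrib flip: sum_distrib_right)
  also have "(\<Sum>i<n. s\<^sup>2 * (u $ i)\<^sup>2) = s\<^sup>2 * (u \<bullet> u)"
    using u_vec by (simp add: scalar_prod_def power2_eq_square sum_distrib_left lessThan_atLeast0)
  finally show ?thesis
    using u_nz by simp
qed

lemma norm_sum_mset_le:
  fixes f :: "'a \<Rightarrow> 'b :: real_normed_vector"
  shows "norm (\<Sum>x\<in>#M. f x) \<le> (\<Sum>x\<in>#M. norm (f x))"
  by (induction M) (auto intro: norm_triangle_mono)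

lemma mat_trace_pow_le:
  fixes S :: "real mat"
  assumes S: "S \<in> carrier_mat n n"
  defines "M \<equiv> proots (char_poly (map_mat complex_of_real S))"
  assumes e: "e \<in># M" and rest: "\<And>y. y \<in># M - {#e#} \<Longrightarrow> cmod y \<le> \<rho>"
  shows "mat_trace (S ^\<^sub>m k) \<le> cmod e ^ k + real (size (M - {#e#})) * \<rho> ^ k"
proof -
  have "complex_of_real (mat_trace (S ^\<^sub>m k)) = mat_trace (map_mat complex_of_real S ^\<^sub>m k)"
    using S by (simp add: mat_trace_def flip: of_real_hom.mat_hom_pow)
  also have "\<dots> = (\<Sum>y\<in>#add_mset e (M - {#e#}). y ^ k)"
    unfolding M_def[symmetric] insert_DiffM[OF e]
    using mat_trace_pow_eq_sum_proots[of "map_mat complex_of_real S" n k] S by (simp add: M_def)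
  finally have "mat_trace (S ^\<^sub>m k) \<le> cmod (e ^ k + (\<Sum>y\<in>#M - {#e#}. y ^ k))"
    using abs_ge_self[of "mat_trace (S ^\<^sub>m k)"]
      norm_of_real[of "mat_trace (S ^\<^sub>m k)", where 'a = complex] by simp
  also have "\<dots> \<le> cmod e ^ k + (\<Sum>y\<in>#M - {#e#}. cmod y ^ k)"
    by (simp add: norm_triangle_mono norm_sum_mset_le flip: norm_power)
  also have "(\<Sum>y\<in>#M - {#e#}. cmod y ^ k) \<le> (\<Sum>y\<in>#M - {#e#}. \<rho> ^ k)"
    by (intro sum_mset_mono power_mono rest) auto
  finally show ?thesis
    by simp
qed

lemma symmetric_pow_orth_eigenvector_le:
  fixes S :: "real mat"
  assumes S: "S \<in> carrier_mat n n" "S\<^sup>T = S" and u: "eigenvector S u s"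
  defines "M \<equiv> proots (char_poly (map_mat complex_of_real S))"
  assumes e: "e \<in># M" "cmod e \<le> \<bar>s\<bar>"
    and rest: "\<And>y. y \<in># M - {#e#} \<Longrightarrow> cmod y \<le> \<rho>"
    and x: "x \<in> carrier_vec n" "u \<bullet> x = 0"
  shows "(S ^\<^sub>m k *\<^sub>v x) \<bullet> (S ^\<^sub>m k *\<^sub>v x) \<le> real (size (M - {#e#})) * (x \<bullet> x) * (\<rho>\<^sup>2) ^ k"
proof -
  define m where "m = real (size (M - {#e#}))"
  have pow: "S ^\<^sub>m k \<in> carrier_mat n n" "(S ^\<^sub>m k)\<^sup>T = S ^\<^sub>m k"
    using S by (simp_all add: transpose_pow_mat)
  have "mat_trace (S ^\<^sub>m (k + k)) \<le> cmod e ^ (k + k) + m * \<rho> ^ (k + k)"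
    using mat_trace_pow_le[OF S(1), of e \<rho> "k + k"] e rest by (simp add: M_def m_def)
  moreover have "cmod e ^ (k + k) \<le> \<bar>s\<bar> ^ (k + k)"
    using e(2) by (rule power_mono) simp
  moreover have "\<bar>s\<bar> ^ (k + k) = (s ^ k)\<^sup>2" "\<rho> ^ (k + k) = (\<rho>\<^sup>2) ^ k"
    by (simp_all add: power_add power2_eq_square power_mult_distrib flip: power_abs)
  ultimately have trace_le: "mat_trace (S ^\<^sub>m k * S ^\<^sub>m k) - (s ^ k)\<^sup>2 \<le> m * (\<rho>\<^sup>2) ^ k"
    by (simp flip: pow_mat_add[OF S(1)])
  have "eigenvector (S ^\<^sub>m k) u (s ^ k)"
    using eigenvector_pow[OF S(1) u] u S(1) by (simp add: eigenvector_def)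
  then have "(S ^\<^sub>m k *\<^sub>v x) \<bullet> (S ^\<^sub>m k *\<^sub>v x)
      \<le> (mat_trace (S ^\<^sub>m k * S ^\<^sub>m k) - (s ^ k)\<^sup>2) * (x \<bullet> x)"
    by (rule symmetric_orth_eigenvector_le_trace[OF pow _ x])
  also have "\<dots> \<le> m * (\<rho>\<^sup>2) ^ k * (x \<bullet> x)"
    using trace_le scalar_prod_self_nonneg by (rule mult_right_mono)
  finally show ?thesis
    by (simp add: m_def mult_ac)
qed

lemma symmetric_pow_log_convex:
  fixes S :: "real mat"
  assumes S: "S \<in> carrier_mat n n" "S\<^sup>T = S" and x: "x \<in> carrier_vec n"
  defines "y \<equiv> \<lambda>k. S ^\<^sub>m k *\<^sub>v x"
  shows "(y (Suc k) \<bullet> y (Suc k))\<^sup>2 \<le> (y k \<bullet> y k) * (y (Suc (Suc k)) \<bullet> y (Suc (Suc k)))"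
proof -
  have y: "y k \<in> carrier_vec n" for k
    unfolding y_def by (rule mult_mat_vec_carrier[OF pow_carrier_mat[OF S(1)] x])
  have y_Suc: "y (Suc k) = S *\<^sub>v y k" for k
    using pow_mat_add[OF S(1), of 1 k] assoc_mult_mat_vec[OF S(1) pow_carrier_mat[OF S(1)] x] S(1)
    by (simp add: y_def)
  have "y (Suc k) \<bullet> y (Suc k) = y k \<bullet> y (Suc (Suc k))"
    using transpose_vec_mult_scalar[OF S(1) y[of "Suc k"] y[of k]] by (simp add: S(2) y_Suc)
  then show ?thesis
    using scalar_prod_Cauchy_Schwarz[OF y y] by simp
qed

lemma symmetric_contracts_orth_eigenvector:
  fixes S :: "real mat"
  assumes S: "S \<in> carrier_mat n n" "S\<^sup>T = S" and u: "eigenvector S u s"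
  defines "M \<equiv> proots (char_poly (map_mat complex_of_real S))"
  assumes e: "e \<in># M" "cmod e \<le> \<bar>s\<bar>"
    and rest: "\<And>y. y \<in># M - {#e#} \<Longrightarrow> cmod y \<le> \<rho>"
    and x: "x \<in> carrier_vec n" "u \<bullet> x = 0"
  shows "(S *\<^sub>v x) \<bullet> (S *\<^sub>v x) \<le> \<rho>\<^sup>2 * (x \<bullet> x)"
proof -
  define a where "a k = (S ^\<^sub>m k *\<^sub>v x) \<bullet> (S ^\<^sub>m k *\<^sub>v x)" for k
  have "a 1 \<le> \<rho>\<^sup>2 * a 0"
  proof (rule log_convex_first_ratio_le)
    show "a k \<le> real (size (M - {#e#})) * (x \<bullet> x) * (\<rho>\<^sup>2) ^ k" for k
      unfolding a_def M_def
      by (rule symmetric_pow_orth_eigenvector_le[OF S u _ e(2) _ x])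
        (use e rest in \<open>auto simp: M_def\<close>)
    show "(a (Suc k))\<^sup>2 \<le> a k * a (Suc (Suc k))" for k
      unfolding a_def by (rule symmetric_pow_log_convex[OF S x(1)])
  qed (simp_all add: a_def scalar_prod_self_nonneg)
  then show ?thesis
    using S(1) x(1) by (simp add: a_def)
qed

lemma norm_eigenvalue_le_row_sum:
  fixes A :: "'a :: real_normed_field mat"
  assumes A: "A \<in> carrier_mat n n" and ev: "eigenvalue A k"
    and row_sum: "\<And>i. i < n \<Longrightarrow> (\<Sum>j<n. norm (A $$ (i, j))) \<le> r"
  shows "norm k \<le> r"
proof -
  obtain x where x: "x \<in> carrier_vec n" "x \<noteq> 0\<^sub>v n" and eq: "A *\<^sub>v x = k \<cdot>\<^sub>v x"
    using ev A by (auto simp: eigenvalue_def eigenvector_def)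
  obtain j where j: "j < n" "x $ j \<noteq> 0"
    using x by (auto simp: vec_eq_iff)
  define m where "m = (MAX i\<in>{..<n}. norm (x $ i))"
  have le_m: "norm (x $ i) \<le> m" if "i < n" for i
    unfolding m_def using that by (intro Max_ge) auto
  have "0 < norm (x $ j)"
    using j(2) by simp
  also have "\<dots> \<le> m"
    by (rule le_m[OF j(1)])
  finally have "0 < m" .
  have "m \<in> (\<lambda>i. norm (x $ i)) ` {..<n}"
    unfolding m_def using j(1) by (intro Max_in) auto
  then obtain i where i: "i < n" "norm (x $ i) = m"
    by auto
  have "norm k * m = norm ((A *\<^sub>v x) $ i)"
    using eq i x(1) by (simp add: norm_mult)
  also have "\<dots> = norm (\<Sum>j<n. A $$ (i, j) * x $ j)"
    using A x(1) i(1) by (simp add: scalar_prod_def lessThan_atLeast0)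
  also have "\<dots> \<le> (\<Sum>j<n. norm (A $$ (i, j)) * m)"
    by (intro sum_norm_le) (simp add: norm_mult le_m mult_left_mono)
  also have "\<dots> \<le> r * m"
    using row_sum[OF i(1)] \<open>0 < m\<close> by (simp flip: sum_distrib_right)
  finally show ?thesis
    using \<open>0 < m\<close> by simp
qed

subsection \<open>Averages and Euclidean norms\<close>

definition avg :: "nat \<Rightarrow> (nat \<Rightarrow> real) \<Rightarrow> real" where
  "avg n h = (\<Sum>v<n. h v) / real n"

lemma avg_mono: "(\<And>v. v < n \<Longrightarrow> g v \<le> h v) \<Longrightarrow> avg n g \<le> avg n h"
  by (auto simp: avg_def intro!: divide_right_mono sum_mono)

lemma avg_nonneg: "(\<And>v. v < n \<Longrightarrow> 0 \<le> h v) \<Longrightarrow> 0 \<le> avg n h"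
  by (auto simp: avg_def intro!: divide_nonneg_nonneg sum_nonneg)

lemma avg_const: "n \<ge> 1 \<Longrightarrow> avg n (\<lambda>_. c) = c"
  by (simp add: avg_def)

lemma avg_square_eq_L2_set: "avg n (\<lambda>v. (q v)\<^sup>2) = (L2_set q {..<n})\<^sup>2 / real n"
  by (simp add: avg_def L2_set_def sum_nonneg)

lemma L2_set_cmult: "L2_set (\<lambda>i. c * f i) I = \<bar>c\<bar> * L2_set f I"
  by (simp add: L2_set_def power_mult_distrib real_sqrt_mult flip: sum_distrib_left)

lemma L2_set_mult_le:
  assumes "\<And>i. i \<in> I \<Longrightarrow> \<bar>q i\<bar> \<le> c" "0 \<le> c"
  shows "L2_set (\<lambda>i. q i * f i) I \<le> c * L2_set f I"
proof -
  have "L2_set (\<lambda>i. \<bar>q i * f i\<bar>) I \<le> L2_set (\<lambda>i. c * \<bar>f i\<bar>) I"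
    by (rule L2_set_mono) (simp_all add: assms abs_mult mult_right_mono)
  then show ?thesis
    using assms(2) by (simp add: L2_set_cmult) (simp add: L2_set_def)
qed

lemma abs_sum_mult_le_L2_set: "\<bar>\<Sum>i\<in>I. f i * g i\<bar> \<le> L2_set f I * L2_set g I"
  using sum_abs[of "\<lambda>i. f i * g i" I] L2_set_mult_ineq[of f g I] by (simp add: abs_mult)

lemma L2_set_add_const_if_sum_zero:
  assumes "(\<Sum>i\<in>I. y i) = 0"
  shows "(L2_set (\<lambda>i. c + y i) I)\<^sup>2 = real (card I) * c\<^sup>2 + (L2_set y I)\<^sup>2"
  using assms
  by (simp add: L2_set_def sum_nonneg power2_sum sum.distrib flip: sum_distrib_left)

subsection \<open>The transition operator of an expander\<close>

definition transition ::
  "nat \<Rightarrow> (nat \<Rightarrow> nat \<Rightarrow> nat) \<Rightarrow> nat \<Rightarrow> (nat \<Rightarrow> real) \<Rightarrow> nat \<Rightarrow> real" where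
  "transition n A d h u = (\<Sum>v<n. real (A u v) * h v) / real d"

lemma expander_imp_regular: "expander n A d lam \<Longrightarrow> regular n A d"
  by (simp add: expander_def)

lemma regular_row_sum:
  assumes "regular n A d" "u < n"
  shows "(\<Sum>v<n. of_nat (A u v)) = (of_nat d :: 'a :: semiring_1)"
proof -
  have "(\<Sum>v<n. A u v) = d"
    using assms unfolding regular_def by blast
  then show ?thesis
    by (simp flip: of_nat_sum)
qed

lemma transition_add_const:
  assumes "regular n A d" "u < n"
  shows "transition n A d (\<lambda>v. c + h v) u = c + transition n A d h u"
proof -
  have "d \<noteq> 0"
    using assms by (simp add: regular_def)
  then show ?thesis
    by (simp add: transition_def distrib_left sum.distrib add_divide_distrib
        regular_row_sum[OF assms] flip: sum_distrib_right)
qed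

lemma sum_transition:
  assumes "regular n A d"
  shows "(\<Sum>u<n. transition n A d h u) = (\<Sum>v<n. h v)"
proof -
  have "d \<noteq> 0"
    using assms by (simp add: regular_def)
  have "(\<Sum>u<n. transition n A d h u) = (\<Sum>v<n. (\<Sum>u<n. real (A u v)) * h v) / real d"
    unfolding transition_def sum_divide_distrib sum_distrib_right by (rule sum.swap)
  also have "\<dots> = (\<Sum>v<n. (\<Sum>u<n. real (A v u)) * h v) / real d"
    using assms by (simp add: regular_def)
  also have "\<dots> = (\<Sum>v<n. h v)"
    using \<open>d \<noteq> 0\<close> by (simp add: regular_row_sum[OF assms] flip: sum_distrib_left)
  finally show ?thesis .
qed

lemma scalar_prod_vec_self: "vec n h \<bullet> vec n h = (L2_set h {..<n})\<^sup>2"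
  by (simp add: scalar_prod_def L2_set_def sum_nonneg lessThan_atLeast0 power2_eq_square)

lemma expander_eigenvalues:
  assumes ex: "expander n A d lam"
  obtains e where "e \<in># eigenvalues_mset n A" "cmod e \<le> real d"
    "\<And>x. x \<in># eigenvalues_mset n A - {#e#} \<Longrightarrow> cmod x \<le> real d * lam"
proof -
  obtain e where e: "e \<in># eigenvalues_mset n A"
    and rest: "\<And>x. x \<in># eigenvalues_mset n A - {#e#} \<Longrightarrow> cmod x \<le> real d * lam"
    using ex by (auto simp: expander_def Let_def)
  have carrier: "adj_mat n A \<in> carrier_mat n n"
    by (simp add: adj_mat_def)
  have "char_poly (adj_mat n A) \<noteq> 0"
    using e by (auto simp: eigenvalues_mset_def)
  then have "eigenvalue (adj_mat n A) e"
    using e by (simp add: eigenvalue_root_char_poly[OF carrier] eigenvalues_mset_def)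
  then have "cmod e \<le> real d"
    by (rule norm_eigenvalue_le_row_sum[OF carrier])
      (simp add: adj_mat_def regular_row_sum[OF expander_imp_regular[OF ex]])
  then show thesis
    using e rest that by blast
qed

lemma expander_transition_contracts:
  assumes ex: "expander n A d lam" and "0 \<le> lam" "n \<ge> 1" and h: "(\<Sum>v<n. h v) = 0"
  shows "L2_set (transition n A d h) {..<n} \<le> lam * L2_set h {..<n}"
proof -
  define S where "S = mat n n (\<lambda>(u, v). real (A u v))"
  define M where "M = proots (char_poly (map_mat complex_of_real S))"
  note reg = expander_imp_regular[OF ex]
  have "0 < d"
    using reg by (simp add: regular_def)
  have S: "S \<in> carrier_mat n n" "S\<^sup>T = S"
    using reg by (auto simp: S_def regular_def)
  have "map_mat complex_of_real S = adj_mat n A"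
    by (auto simp: S_def adj_mat_def)
  then obtain e where e: "e \<in># M" "cmod e \<le> \<bar>real d\<bar>"
    and rest: "\<And>y. y \<in># M - {#e#} \<Longrightarrow> cmod y \<le> real d * lam"
    using expander_eigenvalues[OF ex] by (auto simp: M_def eigenvalues_mset_def)
  have "eigenvector S (vec n (\<lambda>_. 1)) (real d)"
    using \<open>n \<ge> 1\<close> regular_row_sum[OF reg]
    by (auto simp: eigenvector_def S_def scalar_prod_def vec_eq_iff lessThan_atLeast0
        intro: exI[of _ 0])
  moreover have "vec n (\<lambda>_. 1) \<bullet> vec n h = 0"
    using h by (simp add: scalar_prod_def lessThan_atLeast0)
  ultimately have "(S *\<^sub>v vec n h) \<bullet> (S *\<^sub>v vec n h) \<le> (real d * lam)\<^sup>2 * (vec n h \<bullet> vec n h)"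
    using symmetric_contracts_orth_eigenvector[OF S, of _ "real d" e "real d * lam" "vec n h"] e rest
    by (simp add: M_def)
  moreover have "S *\<^sub>v vec n h = real d \<cdot>\<^sub>v vec n (transition n A d h)"
    using \<open>0 < d\<close> by (auto simp: S_def scalar_prod_def transition_def lessThan_atLeast0)
  ultimately have "(real d * L2_set (transition n A d h) {..<n})\<^sup>2
      \<le> (real d * (lam * L2_set h {..<n}))\<^sup>2"
    by (simp add: scalar_prod_vec_self power_mult_distrib mult_ac power2_eq_square[of "real d"])
  then have "real d * L2_set (transition n A d h) {..<n} \<le> real d * (lam * L2_set h {..<n})"
    by (rule power2_le_imp_le) (simp add: \<open>0 \<le> lam\<close>)
  then show ?thesis
    using \<open>0 < d\<close> by simp
qed

lemma expander_transition_near_avg: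
  assumes ex: "expander n A d lam" and "0 \<le> lam" "n \<ge> 1"
  shows "L2_set (\<lambda>u. transition n A d h u - (1 - lam) * avg n h) {..<n} \<le> lam * L2_set h {..<n}"
proof -
  define m where "m = avg n h"
  define y where "y v = h v - m" for v
  note reg = expander_imp_regular[OF ex]
  have y_sum: "(\<Sum>v<n. y v) = 0"
    using \<open>n \<ge> 1\<close> by (simp add: y_def m_def avg_def sum_subtractf)
  have h_eq: "h = (\<lambda>v. m + y v)"
    by (simp add: y_def)
  have "transition n A d h u - (1 - lam) * m = lam * m + transition n A d y u" if "u < n" for u
    using transition_add_const[OF reg that, of m y] by (simp add: algebra_simps flip: h_eq)
  then have "(L2_set (\<lambda>u. transition n A d h u - (1 - lam) * m) {..<n})\<^sup>2
      = (L2_set (\<lambda>u. lam * m + transition n A d y u) {..<n})\<^sup>2"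
    by (simp cong: L2_set_cong_simp)
  also have "\<dots> = real n * (lam * m)\<^sup>2 + (L2_set (transition n A d y) {..<n})\<^sup>2"
    using y_sum by (subst L2_set_add_const_if_sum_zero) (simp_all add: sum_transition[OF reg])
  also have "\<dots> \<le> real n * (lam * m)\<^sup>2 + (lam * L2_set y {..<n})\<^sup>2"
    using expander_transition_contracts[OF ex \<open>0 \<le> lam\<close> \<open>n \<ge> 1\<close> y_sum]
    by (intro add_left_mono power_mono) auto
  also have "\<dots> = (lam * L2_set h {..<n})\<^sup>2"
    using L2_set_add_const_if_sum_zero[OF y_sum, of m]
    by (simp add: power_mult_distrib algebra_simps flip: h_eq)
  finally show ?thesis
    unfolding m_def by (rule power2_le_imp_le) (simp add: \<open>0 \<le> lam\<close>)
qed

subsection \<open>The tilted transition operator\<close>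

definition tilted_transition ::
  "nat \<Rightarrow> (nat \<Rightarrow> nat \<Rightarrow> nat) \<Rightarrow> nat \<Rightarrow> (nat \<Rightarrow> real) \<Rightarrow> (nat \<Rightarrow> real) \<Rightarrow> nat \<Rightarrow> real" where
  "tilted_transition n A d g h = transition n A d (\<lambda>v. g v * h v)"

definition symmetrized_transition ::
  "nat \<Rightarrow> (nat \<Rightarrow> nat \<Rightarrow> nat) \<Rightarrow> nat \<Rightarrow> (nat \<Rightarrow> real) \<Rightarrow> (nat \<Rightarrow> real) \<Rightarrow> nat \<Rightarrow> real" where
  "symmetrized_transition n A d q h u = q u * tilted_transition n A d q h u"

lemma symmetrized_transition_funpow:
  assumes q: "\<And>v. v < n \<Longrightarrow> (q v)\<^sup>2 = g v"
  shows "(symmetrized_transition n A d q ^^ k) (\<lambda>v. q v * h v) u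
    = q u * (tilted_transition n A d g ^^ k) h u"
proof -
  have step: "symmetrized_transition n A d q (\<lambda>v. q v * x v)
      = (\<lambda>u. q u * tilted_transition n A d g x u)" for x
    by (simp add: fun_eq_iff symmetrized_transition_def tilted_transition_def transition_def
        power2_eq_square mult.assoc flip: q)
  have "(symmetrized_transition n A d q ^^ k) (\<lambda>v. q v * h v)
      = (\<lambda>u. q u * (tilted_transition n A d g ^^ k) h u)"
  proof (induction k)
    case (Suc k)
    then show ?case
      by (simp add: step)
  qed simp
  then show ?thesis
    by simp
qed

lemma L2_set_symmetrized_transition_le:
  assumes ex: "expander n A d lam" and lam: "0 \<le> lam" "lam \<le> 1" and n: "n \<ge> 1"
    and q: "\<And>v. v < n \<Longrightarrow> \<bar>q v\<bar> \<le> c"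
  shows "L2_set (symmetrized_transition n A d q h) {..<n}
    \<le> ((1 - lam) * avg n (\<lambda>v. (q v)\<^sup>2) + lam * c\<^sup>2) * L2_set h {..<n}"
proof -
  define x where "x v = q v * h v" for v
  define m where "m = (1 - lam) * avg n x"
  define r where "r u = transition n A d x u - m" for u
  have c: "0 \<le> c"
    using q[of 0] n by simp
  have "\<bar>m\<bar> \<le> (1 - lam) * (L2_set q {..<n} * L2_set h {..<n} / real n)"
    using lam by (simp add: m_def avg_def x_def abs_mult abs_sum_mult_le_L2_set mult_left_mono
        divide_right_mono)
  from mult_right_mono[OF this, of "L2_set q {..<n}"]
  have avg_part: "L2_set (\<lambda>u. m * q u) {..<n} \<le> (1 - lam) * avg n (\<lambda>v. (q v)\<^sup>2) * L2_set h {..<n}"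
    unfolding avg_square_eq_L2_set by (simp add: L2_set_cmult power2_eq_square mult_ac)
  have "L2_set r {..<n} \<le> lam * L2_set x {..<n}"
    unfolding r_def m_def by (rule expander_transition_near_avg[OF ex lam(1) n])
  also have "\<dots> \<le> lam * (c * L2_set h {..<n})"
    unfolding x_def by (intro mult_left_mono L2_set_mult_le) (simp_all add: q c lam)
  finally have "c * L2_set r {..<n} \<le> lam * c\<^sup>2 * L2_set h {..<n}"
    using mult_left_mono[OF _ c] by (fastforce simp: power2_eq_square mult_ac)
  moreover have "L2_set (\<lambda>u. q u * r u) {..<n} \<le> c * L2_set r {..<n}"
    by (rule L2_set_mult_le) (simp_all add: q c)
  ultimately have remainder: "L2_set (\<lambda>u. q u * r u) {..<n} \<le> lam * c\<^sup>2 * L2_set h {..<n}"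
    by simp
  have "symmetrized_transition n A d q h = (\<lambda>u. m * q u + q u * r u)"
    by (simp add: fun_eq_iff symmetrized_transition_def tilted_transition_def r_def x_def[abs_def]
        algebra_simps)
  then have "L2_set (symmetrized_transition n A d q h) {..<n}
      \<le> L2_set (\<lambda>u. m * q u) {..<n} + L2_set (\<lambda>u. q u * r u) {..<n}"
    by (simp add: L2_set_triangle_ineq)
  with avg_part remainder show ?thesis
    by (simp add: distrib_right)
qed

lemma avg_symmetrized_transition_funpow_le:
  assumes ex: "expander n A d lam" and lam: "0 \<le> lam" "lam \<le> 1" and n: "n \<ge> 1"
    and q: "\<And>v. v < n \<Longrightarrow> \<bar>q v\<bar> \<le> c"
  shows "avg n (\<lambda>v. q v * (symmetrized_transition n A d q ^^ l) q v)
    \<le> ((1 - lam) * avg n (\<lambda>v. (q v)\<^sup>2) + lam * c\<^sup>2) ^ Suc l"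
proof -
  define \<beta> where "\<beta> = (1 - lam) * avg n (\<lambda>v. (q v)\<^sup>2) + lam * c\<^sup>2"
  have "avg n (\<lambda>v. (q v)\<^sup>2) \<le> avg n (\<lambda>_. c\<^sup>2)"
    using power_mono[OF q, of _ 2] by (auto intro: avg_mono)
  then have avg_le: "avg n (\<lambda>v. (q v)\<^sup>2) \<le> \<beta>"
    using mult_left_mono[OF _ lam(1)] by (fastforce simp: \<beta>_def avg_const[OF n] algebra_simps)
  have "0 \<le> avg n (\<lambda>v. (q v)\<^sup>2)"
    by (rule avg_nonneg) simp
  with avg_le have \<beta>: "0 \<le> \<beta>"
    by simp
  have power: "L2_set ((symmetrized_transition n A d q ^^ l) q) {..<n} \<le> \<beta> ^ l * L2_set q {..<n}"
  proof (induction l)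
    case (Suc l)
    have "L2_set ((symmetrized_transition n A d q ^^ Suc l) q) {..<n}
        \<le> \<beta> * L2_set ((symmetrized_transition n A d q ^^ l) q) {..<n}"
      unfolding \<beta>_def using L2_set_symmetrized_transition_le[OF ex lam n q] by simp
    also have "\<dots> \<le> \<beta> * (\<beta> ^ l * L2_set q {..<n})"
      by (rule mult_left_mono[OF Suc \<beta>])
    finally show ?case
      by simp
  qed simp
  have "(\<Sum>v<n. q v * (symmetrized_transition n A d q ^^ l) q v)
      \<le> L2_set q {..<n} * L2_set ((symmetrized_transition n A d q ^^ l) q) {..<n}"
    using abs_sum_mult_le_L2_set abs_le_iff by blast
  also have "\<dots> \<le> L2_set q {..<n} * (\<beta> ^ l * L2_set q {..<n})"
    by (rule mult_left_mono[OF power]) simp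
  finally have "avg n (\<lambda>v. q v * (symmetrized_transition n A d q ^^ l) q v)
      \<le> \<beta> ^ l * avg n (\<lambda>v. (q v)\<^sup>2)"
    unfolding avg_square_eq_L2_set by (simp add: avg_def divide_right_mono power2_eq_square mult_ac)
  also have "\<dots> \<le> \<beta> ^ l * \<beta>"
    using \<beta> by (intro mult_left_mono[OF avg_le]) simp
  finally show ?thesis
    by (simp add: \<beta>_def mult.commute)
qed

subsection \<open>The moment generating function of a random walk\<close>

lemma
  assumes reg: "regular n A d" and u: "u < n"
  shows set_step_pmf_subset: "set_pmf (step_pmf n A u) \<subseteq> {..<n}"
    and expectation_step_pmf: "measure_pmf.expectation (step_pmf n A u) h = transition n A d h u"
proof -
  define M where "M = (\<Sum>v<n. replicate_mset (A u v) v)"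
  have size: "size M = d"
    using regular_row_sum[OF reg u, where 'a = nat] by (simp add: M_def)
  then have "M \<noteq> {#}"
    using reg by (auto simp: regular_def)
  have step: "step_pmf n A u = pmf_of_multiset M"
    by (simp add: step_pmf_def M_def)
  have count: "count M v = A u v" if "v < n" for v
    using that by (simp add: M_def count_sum)
  show subset: "set_pmf (step_pmf n A u) \<subseteq> {..<n}"
    using \<open>M \<noteq> {#}\<close> by (auto simp: step M_def set_mset_sum split: if_splits)
  then show "measure_pmf.expectation (step_pmf n A u) h = transition n A d h u"
    by (subst integral_measure_pmf[of "{..<n}"])
      (auto simp: step \<open>M \<noteq> {#}\<close> size count transition_def sum_divide_distrib)
qed

lemma
  assumes reg: "regular n A d" and n: "n \<ge> 1" and w: "w \<in> set_pmf (walk_pmf n A l)"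
  shows walk_pmf_vertices: "set w \<subseteq> {..<n}" and walk_pmf_length: "length w = l"
proof -
  have "set w \<subseteq> {..<n} \<and> length w = l"
    using w
  proof (induction l arbitrary: w)
    case (Suc l)
    show ?case
    proof (cases "l = 0")
      case True
      then show ?thesis
        using Suc.prems n by (auto simp: set_pmf_of_set lessThan_empty_iff)
    next
      case False
      then obtain w' v where w': "w' \<in> set_pmf (walk_pmf n A l)"
        and v: "v \<in> set_pmf (step_pmf n A (last w'))" and w: "w = w' @ [v]"
        using Suc.prems by auto
      have "last w' \<in> set w'"
        using Suc.IH[OF w'] False by (intro last_in_set) auto
      then show ?thesis
        using Suc.IH[OF w'] v set_step_pmf_subset[OF reg, of "last w'"] by (auto simp: w)
    qed
  qed simp
  then show "set w \<subseteq> {..<n}" "length w = l"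
    by simp_all
qed

lemma finite_set_walk_pmf:
  assumes "regular n A d" "n \<ge> 1"
  shows "finite (set_pmf (walk_pmf n A l))"
  by (rule finite_subset[OF _ finite_lists_length_eq[of "{..<n}" l]])
    (use walk_pmf_vertices[OF assms] walk_pmf_length[OF assms] in auto)

lemma expectation_walk_pmf_prod_list:
  assumes reg: "regular n A d" and n: "n \<ge> 1"
  shows "measure_pmf.expectation (walk_pmf n A (Suc l)) (\<lambda>w. prod_list (map g w) * h (last w))
    = avg n (\<lambda>v. g v * (tilted_transition n A d g ^^ l) h v)"
proof (induction l arbitrary: h)
  case 0
  then show ?case
    using n by (simp add: integral_pmf_of_set lessThan_empty_iff avg_def)
next
  case (Suc l)
  define W where "W = walk_pmf n A (Suc l)"
  define E where "E w = map_pmf (\<lambda>v. w @ [v]) (step_pmf n A (last w))" for w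
  define F where "F h w = prod_list (map g w) * h (last w)" for h w
  have fin_W: "finite (set_pmf W)"
    unfolding W_def by (rule finite_set_walk_pmf[OF assms])
  have last_less: "last w < n" if "w \<in> set_pmf W" for w
    using that walk_pmf_vertices[OF assms, of w "Suc l"] walk_pmf_length[OF assms, of w "Suc l"]
      last_in_set[of w] unfolding W_def by fastforce
  have fin_E: "finite (set_pmf (E w))" if "w \<in> set_pmf W" for w
    using finite_subset[OF set_step_pmf_subset[OF reg last_less[OF that]]] by (simp add: E_def)
  have step: "measure_pmf.expectation (E w) (F h) = F (tilted_transition n A d g h) w"
    if "w \<in> set_pmf W" for w
    using expectation_step_pmf[OF reg last_less[OF that], of "\<lambda>v. g v * h v"]
    by (simp add: E_def F_def tilted_transition_def mult.assoc)
  have "measure_pmf.expectation (walk_pmf n A (Suc (Suc l))) (F h)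
      = measure_pmf.expectation (W \<bind> E) (F h)"
    by (simp only: W_def E_def[abs_def] walk_pmf.simps(2)[of n A "Suc l"] nat.distinct if_False)
  also have "\<dots> = (\<Sum>w\<in>set_pmf W. pmf W w *\<^sub>R measure_pmf.expectation (E w) (F h))"
    by (rule pmf_expectation_bind[OF fin_W fin_E]) auto
  also have "\<dots> = (\<Sum>w\<in>set_pmf W. pmf W w *\<^sub>R F (tilted_transition n A d g h) w)"
    by (simp add: step)
  also have "\<dots> = measure_pmf.expectation W (F (tilted_transition n A d g h))"
    by (rule integral_measure_pmf[OF fin_W, symmetric]) auto
  finally show ?case
    unfolding F_def W_def Suc.IH by (simp add: funpow_swap1)
qed

lemma expectation_walk_pmf_prod_list_le:
  assumes ex: "expander n A d lam" and lam: "0 \<le> lam" "lam \<le> 1" and n: "n \<ge> 1" and l: "l \<ge> 1"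
    and g: "\<And>v. v < n \<Longrightarrow> 0 \<le> g v" "\<And>v. v < n \<Longrightarrow> g v \<le> c"
  shows "measure_pmf.expectation (walk_pmf n A l) (\<lambda>w. prod_list (map g w))
    \<le> ((1 - lam) * avg n g + lam * c) ^ l"
proof -
  define q where "q v = sqrt (g v)" for v
  obtain k where k: "l = Suc k"
    using l by (cases l) auto
  note reg = expander_imp_regular[OF ex]
  have q_square: "(q v)\<^sup>2 = g v" if "v < n" for v
    using g(1)[OF that] by (simp add: q_def)
  have "0 \<le> c"
    using g[of 0] n by force
  have q_le: "\<bar>q v\<bar> \<le> sqrt c" if "v < n" for v
    using g[OF that] by (simp add: q_def)
  have "g v * (tilted_transition n A d g ^^ k) (\<lambda>_. 1) v
      = q v * (symmetrized_transition n A d q ^^ k) q v"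
    if "v < n" for v
    using symmetrized_transition_funpow[where h = "\<lambda>_. 1" and u = v, OF q_square]
    by (simp add: power2_eq_square mult.assoc flip: q_square[OF that])
  then have symmetrized: "avg n (\<lambda>v. g v * (tilted_transition n A d g ^^ k) (\<lambda>_. 1) v)
      = avg n (\<lambda>v. q v * (symmetrized_transition n A d q ^^ k) q v)"
    by (simp add: avg_def)
  have "measure_pmf.expectation (walk_pmf n A l) (\<lambda>w. prod_list (map g w))
      = avg n (\<lambda>v. g v * (tilted_transition n A d g ^^ k) (\<lambda>_. 1) v)"
    using expectation_walk_pmf_prod_list[OF reg n, of k g "\<lambda>_. 1"] by (simp add: k)
  also have "\<dots> \<le> ((1 - lam) * avg n (\<lambda>v. (q v)\<^sup>2) + lam * (sqrt c)\<^sup>2) ^ l"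
    unfolding symmetrized k by (rule avg_symmetrized_transition_funpow_le[OF ex lam n q_le])
  also have "avg n (\<lambda>v. (q v)\<^sup>2) = avg n g"
    by (simp add: avg_def q_square)
  finally show ?thesis
    using \<open>0 \<le> c\<close> by simp
qed

lemma exp_mult_le_chord:
  fixes t x :: real
  assumes "0 \<le> x" "x \<le> 1"
  shows "exp (t * x) \<le> 1 + (exp t - 1) * x"
  using convex_onD[OF exp_convex, of x 0 t] assms by (simp add: algebra_simps)

lemma avg_exp_mult_le:
  assumes n: "n \<ge> 1" and f: "\<And>v. v < n \<Longrightarrow> 0 \<le> f v" "\<And>v. v < n \<Longrightarrow> f v \<le> 1"
  shows "avg n (\<lambda>v. exp (t * f v)) \<le> 1 + (exp t - 1) * avg n f"
proof -
  have "avg n (\<lambda>v. exp (t * f v)) \<le> avg n (\<lambda>v. 1 + (exp t - 1) * f v)"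
    by (intro avg_mono exp_mult_le_chord f)
  also have "\<dots> = 1 + (exp t - 1) * avg n f"
    using n by (simp add: avg_def sum.distrib add_divide_distrib flip: sum_distrib_left)
  finally show ?thesis .
qed

lemma expectation_exp_walk_sum_le:
  assumes ex: "expander n A d lam" and lam: "0 \<le> lam" "lam \<le> 1" and n: "n \<ge> 1" and l: "l \<ge> 1"
    and f: "\<And>v. v < n \<Longrightarrow> 0 \<le> f v" "\<And>v. v < n \<Longrightarrow> f v \<le> 1" and t: "0 \<le> t"
  shows "measure_pmf.expectation (walk_pmf n A l) (\<lambda>w. exp (t * (\<Sum>i<l. f (w ! i))))
    \<le> (1 + (avg n f + lam) * (exp t - 1)) ^ l"
proof -
  define g where "g v = exp (t * f v)" for v
  define \<beta> where "\<beta> = (1 - lam) * avg n g + lam * exp t"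
  note reg = expander_imp_regular[OF ex]
  have "exp (t * (\<Sum>i<l. f (w ! i))) = prod_list (map g w)"
    if "w \<in> set_pmf (walk_pmf n A l)" for w
    using walk_pmf_length[OF reg n that]
    by (simp add: g_def exp_sum sum_distrib_left prod.list_conv_set_nth lessThan_atLeast0)
  then have "measure_pmf.expectation (walk_pmf n A l) (\<lambda>w. exp (t * (\<Sum>i<l. f (w ! i))))
      = measure_pmf.expectation (walk_pmf n A l) (\<lambda>w. prod_list (map g w))"
    by (intro integral_cong_AE AE_pmfI) auto
  also have "\<dots> \<le> \<beta> ^ l"
    unfolding \<beta>_def using f t
    by (intro expectation_walk_pmf_prod_list_le[OF ex lam n l]) (auto simp: g_def mult_left_le)
  also have "\<dots> \<le> (1 + (avg n f + lam) * (exp t - 1)) ^ l"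
  proof (rule power_mono)
    have "avg n g \<le> 1 + (exp t - 1) * avg n f"
      unfolding g_def by (rule avg_exp_mult_le[OF n f])
    then have "\<beta> \<le> (1 - lam) * (1 + (exp t - 1) * avg n f) + lam * exp t"
      using lam by (simp add: \<beta>_def mult_left_mono)
    also have "\<dots> = 1 + (avg n f + lam) * (exp t - 1) - lam * ((exp t - 1) * avg n f)"
      by (simp add: algebra_simps)
    finally have "\<beta> \<le> 1 + (avg n f + lam) * (exp t - 1) - lam * ((exp t - 1) * avg n f)" .
    moreover have "0 \<le> lam * ((exp t - 1) * avg n f)"
      using lam t by (intro mult_nonneg_nonneg avg_nonneg f) auto
    ultimately show "\<beta> \<le> 1 + (avg n f + lam) * (exp t - 1)"
      by simp
    show "0 \<le> \<beta>"
      unfolding \<beta>_def using lam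
      by (intro add_nonneg_nonneg mult_nonneg_nonneg avg_nonneg) (auto simp: g_def)
  qed
  finally show ?thesis .
qed

lemma prob_walk_sum_ge_le:
  assumes ex: "expander n A d lam" and lam: "0 \<le> lam" "lam \<le> 1" and n: "n \<ge> 1" and l: "l \<ge> 1"
    and f: "\<And>v. v < n \<Longrightarrow> 0 \<le> f v" "\<And>v. v < n \<Longrightarrow> f v \<le> 1" and t: "0 < t"
  shows "measure_pmf.prob (walk_pmf n A l) {w. (\<Sum>i<l. f (w ! i)) \<ge> \<gamma> * real l}
    \<le> (exp (- t * \<gamma>) * (1 + (avg n f + lam) * (exp t - 1))) ^ l"
proof -
  note reg = expander_imp_regular[OF ex]
  have "integrable (walk_pmf n A l) (\<lambda>w. exp (t * (\<Sum>i<l. f (w ! i))))"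
    by (intro integrable_measure_pmf_finite finite_set_walk_pmf[OF reg n])
  then have "measure_pmf.prob (walk_pmf n A l) {w. (\<Sum>i<l. f (w ! i)) \<ge> \<gamma> * real l}
      \<le> exp (- t * (\<gamma> * real l))
        * measure_pmf.expectation (walk_pmf n A l) (\<lambda>w. exp (t * (\<Sum>i<l. f (w ! i))))"
    using measure_pmf.Chernoff_ineq_ge[OF t, of "walk_pmf n A l" UNIV
        "\<lambda>w. \<Sum>i<l. f (w ! i)" "\<gamma> * real l"]
    by (simp add: set_integrable_def set_lebesgue_integral_def)
  also have "\<dots> \<le> exp (- t * (\<gamma> * real l)) * (1 + (avg n f + lam) * (exp t - 1)) ^ l"
    using t by (intro mult_left_mono expectation_exp_walk_sum_le[OF ex lam n l f]) auto
  also have "exp (- t * (\<gamma> * real l)) = exp (- t * \<gamma>) ^ l"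
    by (simp add: mult_ac flip: exp_of_nat_mult)
  finally show ?thesis
    by (simp add: power_mult_distrib)
qed

subsection \<open>The Legendre transform of the Bernoulli moment generating function\<close>

lemma exp_ereal_nonneg: "0 \<le> exp_ereal x"
  by (cases x) (simp_all add: exp_ereal_def)

lemma exp_ereal_minus_mult: "exp_ereal (- (ereal (real l) * ereal x)) = exp (- x) ^ l"
  by (simp add: exp_ereal_def flip: exp_of_nat_mult)

lemma KL_refl: "KL p p = 0"
  by (simp add: KL_def kl_term_def zero_ereal_def)

lemma KL_1_left: "0 < q \<Longrightarrow> KL 1 q = ereal (ln (1 / q))"
  by (simp add: KL_def kl_term_def)

lemma KL_eq_ereal:
  assumes "0 < p" "p < 1" "0 < q" "q < 1"
  shows "KL p q = ereal (p * ln (p / q) + (1 - p) * ln ((1 - p) / (1 - q)))"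
  using assms by (simp add: KL_def kl_term_def)

lemma bernoulli_mgf_at_maximiser:
  fixes p q :: real
  assumes q: "0 < q" "q < p" and p: "p < 1"
  defines "t \<equiv> ln (p * (1 - q) / (q * (1 - p)))"
  shows "0 < t"
    and "exp (- t * p) * (1 + q * (exp t - 1))
      = exp (- (p * ln (p / q) + (1 - p) * ln ((1 - p) / (1 - q))))"
proof -
  have "q * (1 - p) < p * (1 - q)"
    using q by (simp add: algebra_simps)
  then show "0 < t"
    using assms by (simp add: t_def)
  have exp_t: "exp t = p * (1 - q) / (q * (1 - p))"
    using assms by (simp add: t_def)
  have t_eq: "t = ln p + ln (1 - q) - (ln q + ln (1 - p))"
    using assms by (simp add: t_def ln_div ln_mult)
  have "1 + q * (exp t - 1) = (1 - q) / (1 - p)"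
    using q p unfolding exp_t by (simp add: divide_simps) (simp add: algebra_simps)
  also have "\<dots> = exp (ln ((1 - q) / (1 - p)))"
    using q p by simp
  finally have "exp (- t * p) * (1 + q * (exp t - 1)) = exp (- t * p + ln ((1 - q) / (1 - p)))"
    by (simp only: exp_add)
  also have "- t * p + ln ((1 - q) / (1 - p))
      = - (p * ln (p / q) + (1 - p) * ln ((1 - p) / (1 - q)))"
    using q p by (simp add: t_eq ln_div algebra_simps)
  finally show "exp (- t * p) * (1 + q * (exp t - 1))
      = exp (- (p * ln (p / q) + (1 - p) * ln ((1 - p) / (1 - q))))" .
qed

lemma le_exp_KL_if_le_bernoulli_mgf:
  fixes P p q :: real
  assumes q: "0 \<le> q" "q \<le> p" and p: "p \<le> 1" and l: "l \<ge> 1" and "P \<le> 1"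
    and mgf_bound: "\<And>t. 0 < t \<Longrightarrow> P \<le> (exp (- t * p) * (1 + q * (exp t - 1))) ^ l"
  shows "P \<le> exp_ereal (- (ereal (real l) * KL p q))"
proof -
  have le_limit: "P \<le> c ^ l"
    if "((\<lambda>t. exp (- t * p) * (1 + q * (exp t - 1))) \<longlongrightarrow> c) at_top" for c
    by (rule tendsto_lowerbound[OF tendsto_power[OF that]])
      (rule eventually_mono[OF eventually_gt_at_top[of 0] mgf_bound], simp_all)
  consider "p = q" | "q = 0" "0 < p" | "0 < q" "p = 1" | "0 < q" "q < p" "p < 1"
    using q p by fastforce
  then show ?thesis
  proof cases
    case 1
    then show ?thesis
      using \<open>P \<le> 1\<close> by (simp add: KL_refl exp_ereal_def zero_ereal_def)
  next
    case 2
    have "((\<lambda>t. exp (- t * p)) \<longlongrightarrow> 0) at_top"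
      using \<open>0 < p\<close> by real_asymp
    then have "P \<le> 0 ^ l"
      using \<open>q = 0\<close> by (intro le_limit) simp
    then show ?thesis
      using l exp_ereal_nonneg order_trans by (simp add: power_0_left) blast
  next
    case 3
    have "((\<lambda>t. exp (- t) * (1 + q * (exp t - 1))) \<longlongrightarrow> q) at_top"
      using \<open>0 < q\<close> by real_asymp
    then have "P \<le> q ^ l"
      using \<open>p = 1\<close> by (intro le_limit) simp
    also have "\<dots> = exp_ereal (- (ereal (real l) * KL p q))"
      using 3 by (simp only: KL_1_left exp_ereal_minus_mult) (simp add: ln_div)
    finally show ?thesis .
  next
    case 4
    then show ?thesis
      using mgf_bound[OF bernoulli_mgf_at_maximiser(1)[OF 4]]
      by (simp only: bernoulli_mgf_at_maximiser(2)[OF 4] KL_eq_ereal exp_ereal_minus_mult)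
  qed
qed

theorem theorem3:
  fixes n d l :: nat and A :: "nat \<Rightarrow> nat \<Rightarrow> nat" and lam \<gamma> :: real and f :: "nat \<Rightarrow> real"
  assumes "n \<ge> 1"
    and "expander n A d lam"
    and "lam \<ge> 0"
    and "l \<ge> 1"
    and "\<forall>v<n. f v \<in> {0, 1}"
    and "\<mu> = (\<Sum>v<n. f v) / real n"
    and "\<mu> + lam \<le> \<gamma>" and "\<gamma> \<le> 1"
  shows "measure_pmf.prob (walk_pmf n A l) {w. (\<Sum>i<l. f (w ! i)) \<ge> \<gamma> * real l}
           \<le> exp_ereal (- (ereal (real l) * KL \<gamma> (\<mu> + lam)))"
proof (rule le_exp_KL_if_le_bernoulli_mgf)
  have f: "0 \<le> f v" "f v \<le> 1" if "v < n" for v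
    using assms(5) that by force+
  have \<mu>: "\<mu> = avg n f"
    by (simp add: assms(6) avg_def)
  then have "0 \<le> \<mu>"
    by (simp add: avg_nonneg f)
  then show "0 \<le> \<mu> + lam"
    using assms(3) by simp
  have "lam \<le> 1"
    using \<open>0 \<le> \<mu>\<close> assms(7,8) by simp
  then show "measure_pmf.prob (walk_pmf n A l) {w. (\<Sum>i<l. f (w ! i)) \<ge> \<gamma> * real l}
      \<le> (exp (- t * \<gamma>) * (1 + (\<mu> + lam) * (exp t - 1))) ^ l" if "0 < t" for t
    unfolding \<mu> by (intro prob_walk_sum_ge_le[OF assms(2)] assms f that)
qed (use assms in auto)

end
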